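(* Let $m\ge1$ and $a_s\in\mathbb C$ $(-m\le s\le m)$ with $a_{-s}=a_s$ for $0\le s\le m$. For $n>2m$ let $C_n=\sum_{s=-m}^ma_s\Pi_n^s$ and $P_n^{\mathrm{cyc}}=\operatorname{perm}C_n$. Then the stable symmetric circulant permanent sequence $(P_n^{\mathrm{cyc}})_{n>2m}$ has a homogeneous constant-coefficient annihilator of degree at most $$\frac12\left(4^m+\binom{2m}m\right).$$
   Context: $\Pi_n$ is the $n\times n$ cyclic shift matrix, with $(i,j)$ entry $1$ if $j\equiv i+1\pmod n$ and $0$ otherwise. $\operatorname{perm}$ denotes the permanent. "Stable" refers to the range $n>2m$. A homogeneous constant-coefficient annihilator of degree $d$ of $(u_n)_{n>2m}$ is a monic polynomial $t^d+c_1t^{d-1}+\dots+c_d$ with $u_{n+d}+c_1u_{n+d-1}+\dots+c_du_n=0$ for all $n>2m$. *)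

theory Defs
  imports "HOL-Number_Theory.Cong" "HOL-Computational_Algebra.Polynomial" "Jordan_Normal_Form.Determinant"
begin

(* Rows and columns are indexed by {0..<n}; j = i + 1 (mod n) is unaffected by this shift. *)
definition cyclic_shift :: "nat \<Rightarrow> complex mat" where
  "cyclic_shift n = mat n n (\<lambda>(i, j). if [j = i + 1] (mod n) then 1 else 0)"

(* The sum and the integer power are those of the ring of n x n matrices; for s < 0 the power
   uses the inverse in the multiplicative monoid of that ring, in which cyclic_shift n is
   invertible (cyclic_shift_pow below gives the entries of all its powers). *)
definition banded_circulant :: "nat \<Rightarrow> (int \<Rightarrow> complex) \<Rightarrow> nat \<Rightarrow> complex mat" where
  "banded_circulant m a n =
     (let R = ring_mat TYPE(complex) n () in
      \<Oplus>\<^bsub>R\<^esub> s \<in> {- int m..int m}. a s \<cdot>\<^sub>m (cyclic_shift n [^]\<^bsub>R\<^esub> s))"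

lemma shift_mat_mult:
  assumes "n \<ge> 1"
  defines "S \<equiv> \<lambda>s. mat n n (\<lambda>(i, j). if [int j = int i + s] (mod int n) then 1 else (0 :: complex))"
  shows "S s * S t = S (s + t)"
proof (rule eq_matI)
  fix i j assume "i < dim_row (S (s + t))" "j < dim_col (S (s + t))"
  then have ij: "i < n" "j < n" by (auto simp: S_def)
  define k where "k = nat ((int i + s) mod int n)"
  have k: "k < n" "int k = (int i + s) mod int n"
    using assms(1) by (auto simp: k_def nat_less_iff)
  have uniq: "[int l = int i + s] (mod int n) \<longleftrightarrow> l = k" if "l < n" for l
    using that k by (auto simp: cong_def)
  have "(S s * S t) $$ (i, j) = (\<Sum>l<n. S s $$ (i, l) * S t $$ (l, j))"
    using ij by (auto simp: S_def scalar_prod_def lessThan_atLeast0 intro!: sum.cong)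
  also have "\<dots> = (\<Sum>l<n. if l = k then S t $$ (k, j) else 0)"
    using ij uniq by (intro sum.cong) (auto simp: S_def)
  also have "\<dots> = S t $$ (k, j)" using k by simp
  also have "\<dots> = S (s + t) $$ (i, j)"
    using ij k by (simp add: S_def cong_def mod_add_left_eq add.assoc)
  finally show "(S s * S t) $$ (i, j) = S (s + t) $$ (i, j)" .
qed (auto simp: S_def)

lemma shift_mat_0:
  "mat n n (\<lambda>(i, j). if [int j = int i + 0] (mod int n) then 1 else (0 :: complex)) = 1\<^sub>m n"
  by (rule eq_matI) (auto simp: cong_def)

lemma cyclic_shift_pow:
  assumes "n \<ge> 1"
  shows "cyclic_shift n [^]\<^bsub>ring_mat TYPE(complex) n ()\<^esub> (s :: int) =
    mat n n (\<lambda>(i, j). if [int j = int i + s] (mod int n) then 1 else 0)"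
proof -
  define R where "R = ring_mat TYPE(complex) n ()"
  define S where
    "S = (\<lambda>s. mat n n (\<lambda>(i, j). if [int j = int i + s] (mod int n) then 1 else (0 :: complex)))"
  interpret ring R unfolding R_def by (rule ring_mat)
  have mult: "S s \<otimes>\<^bsub>R\<^esub> S t = S (s + t)" for s t
    using shift_mat_mult[OF assms, of s t] by (simp add: S_def R_def ring_mat_simps)
  have S0: "S 0 = \<one>\<^bsub>R\<^esub>"
    using shift_mat_0[of n] by (simp add: S_def R_def ring_mat_simps)
  have carr: "S s \<in> carrier R" for s by (simp add: S_def R_def ring_mat_simps)
  have S1: "cyclic_shift n = S 1"
    by (rule eq_matI) (auto simp: cyclic_shift_def S_def add.commute simp flip: cong_int_iff)
  have pow: "cyclic_shift n [^]\<^bsub>R\<^esub> k = S (int k)" for k :: nat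
    by (induction k) (simp_all add: S0 S1 mult add.commute)
  have "cyclic_shift n [^]\<^bsub>R\<^esub> s = S s"
  proof (cases "s < 0")
    case True
    have "S s = inv\<^bsub>R\<^esub> (S (- s))"
      by (rule inv_unique') (simp_all add: carr mult S0)
    with True show ?thesis by (simp add: int_pow_def2 pow)
  next
    case False
    then show ?thesis by (simp add: int_pow_def2 pow)
  qed
  then show ?thesis by (simp add: R_def S_def)
qed

lemma banded_circulant_eq_mat:
  assumes "n \<ge> 1"
  shows "banded_circulant m a n =
    mat n n (\<lambda>(i, j). \<Sum>s | s \<in> {- int m..int m} \<and> [int j = int i + s] (mod int n). a s)"
proof -
  define R where "R = ring_mat TYPE(complex) n ()"
  define T where "T = (\<lambda>s. a s \<cdot>\<^sub>m (cyclic_shift n [^]\<^bsub>R\<^esub> s))"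
  interpret ring R unfolding R_def by (rule ring_mat)
  have T: "T s = mat n n (\<lambda>(i, j). if [int j = int i + s] (mod int n) then a s else 0)" for s
    by (rule eq_matI) (auto simp: T_def R_def cyclic_shift_pow[OF assms])
  have "(\<Oplus>\<^bsub>R\<^esub> s \<in> A. T s) =
      mat n n (\<lambda>(i, j). \<Sum>s\<in>A. if [int j = int i + s] (mod int n) then a s else 0)"
    if "finite A" for A
    using that
  proof (induction A rule: finite_induct)
    case empty
    have "(\<Oplus>\<^bsub>R\<^esub> s \<in> {}. T s) = 0\<^sub>m n n"
      by (subst finsum_empty) (simp add: R_def ring_mat_simps)
    then show ?case by (auto intro!: eq_matI)
  next
    case (insert s A)
    have "T \<in> A \<rightarrow> carrier R" "T s \<in> carrier R" by (auto simp: T R_def ring_mat_simps)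
    with insert have "(\<Oplus>\<^bsub>R\<^esub> s \<in> insert s A. T s) = T s \<oplus>\<^bsub>R\<^esub> (\<Oplus>\<^bsub>R\<^esub> s \<in> A. T s)"
      by (simp add: finsum_insert)
    then show ?case using insert
      by (auto simp: T R_def ring_mat_simps intro!: eq_matI)
  qed
  from this[of "{- int m..int m}"] show ?thesis
    by (auto simp: banded_circulant_def Let_def R_def T_def sum.If_cases Int_def
        intro!: eq_matI sum.cong)
qed

(* Same conventions as det, without the signs. *)
definition permanent :: "'a :: comm_ring_1 mat \<Rightarrow> 'a" where
  "permanent A = (if dim_row A = dim_col A then
     (\<Sum>p \<in> {p. p permutes {0..<dim_row A}}. \<Prod>i = 0..<dim_row A. A $$ (i, p i)) else 0)"

(* p is a homogeneous constant-coefficient annihilator of the sequence (u_n) restricted to n > N;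
   the coefficient c_k of t^(d-k) is coeff p (d - k). *)
definition annihilator_beyond :: "nat \<Rightarrow> (nat \<Rightarrow> 'a :: comm_ring_1) \<Rightarrow> 'a poly \<Rightarrow> bool" where
  "annihilator_beyond N u p \<longleftrightarrow>
     lead_coeff p = 1 \<and> (\<forall>n > N. (\<Sum>i \<le> degree p. coeff p i * u (n + i)) = 0)"

end

theory Submission
  imports Defs "Jordan_Normal_Form.Char_Poly"
begin

text \<open>
  Expanding the permanent over the nonzero diagonals turns it into a sum over maps
  \<open>f : {0,\<dots>,n-1} \<rightarrow> {0,\<dots>,L}\<close>, \<open>L = 2m\<close>, for which \<open>i \<mapsto> i + f i\<close> is injective modulo \<open>n\<close>:
  periodic juggling patterns, weighted by \<open>\<Prod>i. a (f i - m)\<close>. These are the closed walks of length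
  \<open>n\<close> of a transfer matrix on the subsets of \<open>{0,\<dots>,L-1}\<close> (the pending landing times), and the
  cardinality \<open>k\<close> of the state is conserved. Replacing \<open>f i\<close> by \<open>L - f (n-1-i)\<close> exchanges \<open>k\<close> and
  \<open>2m - k\<close>, and the symmetry of \<open>a\<close> makes this weight preserving. So the permanent is a fixed
  linear combination of entries of the \<open>n\<close>-th power of the transfer matrix restricted to the
  states with \<open>k \<le> m\<close>, and the characteristic polynomial of that matrix is the annihilator.
\<close>

subsection \<open>The Cayley--Hamilton recurrence\<close>

text \<open>This is one entry of (t I - A) adj(t I - A) = det(t I - A) I. Multiplication by t is
  \<open>pCons 0\<close>.\<close>

lemma char_poly_matrix_adjugate:
  fixes A :: "'a :: comm_ring_1 mat"
  assumes A: "A \<in> carrier_mat d d" and ij: "i < d" "j < d"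
  defines "B \<equiv> adj_mat (char_poly_matrix A)"
  shows "pCons 0 (B $$ (i, j)) - (\<Sum>k<d. smult (A $$ (i, k)) (B $$ (k, j))) =
    (if i = j then char_poly A else 0)"
proof -
  define C where "C = char_poly_matrix A"
  have C: "C \<in> carrier_mat d d" using A by (simp add: C_def)
  have B: "B \<in> carrier_mat d d" using adj_mat(1)[OF C] by (simp add: B_def C_def)
  have "(if i = j then char_poly A else 0) = (C * B) $$ (i, j)"
    using adj_mat(2)[OF C] ij by (simp add: B_def C_def char_poly_def)
  also have "\<dots> = (\<Sum>k<d. C $$ (i, k) * B $$ (k, j))"
    using B C ij by (auto simp: scalar_prod_def lessThan_atLeast0 intro!: sum.cong)
  also have "\<dots> = (\<Sum>k<d. (if k = i then pCons 0 (B $$ (k, j)) else 0) - smult (A $$ (i, k)) (B $$ (k, j)))"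
    using A ij by (intro sum.cong) (auto simp: C_def char_poly_matrix_def algebra_simps)
  also have "\<dots> = pCons 0 (B $$ (i, j)) - (\<Sum>k<d. smult (A $$ (i, k)) (B $$ (k, j)))"
    using ij by (simp add: sum_subtractf)
  finally show ?thesis by simp
qed

text \<open>Pairing the row \<open>W n x\<close> with the coefficients of the adjugate identity
  makes the combination with the coefficients of the characteristic polynomial telescope. Only the
  one-step recursion enters, so no matrix powers and no initial value of \<open>W\<close> are
  needed.\<close>

lemma Cayley_Hamilton_recurrence:
  fixes T :: "'b \<Rightarrow> 'b \<Rightarrow> 'a :: comm_ring_1" and W :: "nat \<Rightarrow> 'b \<Rightarrow> 'b \<Rightarrow> 'a"
  assumes fin: "finite V"
    and step: "\<And>n x y. x \<in> V \<Longrightarrow> y \<in> V \<Longrightarrow> W (Suc n) x y = (\<Sum>z\<in>V. W n x z * T z y)"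
  obtains p where "lead_coeff p = 1" "degree p = card V"
    "\<And>n x y. x \<in> V \<Longrightarrow> y \<in> V \<Longrightarrow> (\<Sum>i\<le>degree p. coeff p i * W (n + i) x y) = 0"
proof -
  define d where "d = card V"
  obtain e where e: "bij_betw e {..<d} V"
    using ex_bij_betw_nat_finite[OF fin] by (auto simp: d_def lessThan_atLeast0)
  define A where "A = mat d d (\<lambda>(i, j). T (e i) (e j))"
  have A: "A \<in> carrier_mat d d" by (simp add: A_def)
  define p where "p = char_poly A"
  have p: "lead_coeff p = 1" "degree p = card V"
    using degree_monic_char_poly[OF A] by (auto simp: p_def d_def)
  define e' where "e' = inv_into {..<d} e"
  have e': "e' x < d" "e (e' x) = x" if "x \<in> V" for x
    using that e bij_betw_inv_into_right[OF e] bij_betw_apply[OF bij_betw_inv_into[OF e]]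
    by (auto simp: e'_def)
  have e'_eq: "e' x = e' y \<longleftrightarrow> x = y" if "x \<in> V" "y \<in> V" for x y
    using that e' by metis
  have e'_e: "e' (e i) = i" if "i < d" for i
    using that bij_betw_inv_into_left[OF e] by (simp add: e'_def)
  define B where "B = (\<lambda>x y. adj_mat (char_poly_matrix A) $$ (e' x, e' y))"
  have adj: "pCons 0 (B x y) - (\<Sum>z\<in>V. smult (T x z) (B z y)) = (if x = y then p else 0)"
    if xy: "x \<in> V" "y \<in> V" for x y
  proof -
    have "(\<Sum>z\<in>V. smult (T x z) (B z y)) = (\<Sum>k<d. smult (T x (e k)) (B (e k) y))"
      by (rule sum.reindex_bij_betw[OF e, symmetric])
    also have "\<dots> = (\<Sum>k<d. smult (A $$ (e' x, k)) (adj_mat (char_poly_matrix A) $$ (k, e' y)))"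
      using xy e' by (intro sum.cong) (auto simp: A_def B_def e'_e)
    finally show ?thesis
      using char_poly_matrix_adjugate[OF A, of "e' x" "e' y"] e' e'_eq xy
      by (simp add: B_def p_def)
  qed
  have "(\<Sum>i\<le>degree p. coeff p i * W (n + i) x y) = 0" if xy: "x \<in> V" "y \<in> V" for n x y
  proof -
    \<comment> \<open>Beyond both degrees: summing up to \<open>N\<close> catches all of
      \<open>p\<close>, and the strict bound on the adjugate entries kills the boundary term
      \<open>g (Suc N)\<close>.\<close>
    define N where "N = Suc (Max (insert (degree p) ((\<lambda>z. degree (B z y)) ` V)))"
    have N: "degree p \<le> N" "\<And>z. z \<in> V \<Longrightarrow> degree (B z y) < N"
      using fin by (auto simp: N_def less_Suc_eq_le intro!: le_SucI)
    \<comment> \<open>\<open>g l\<close> pairs \<open>W (n + l)\<close> with coefficient l of t adj.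
      The product T adj paired with \<open>W (n + l)\<close> becomes adj paired with
      \<open>W (n + l + 1)\<close>, which is \<open>g (Suc l)\<close> because the factor t shifts
      coefficients. The same factor gives \<open>g 0 = 0\<close>.\<close>
    define g where "g = (\<lambda>l. \<Sum>z\<in>V. W (n + l) x z * coeff (pCons 0 (B z y)) l)"
    have "coeff p l * W (n + l) x y = g l - g (Suc l)" for l
    proof -
      have "coeff p l * W (n + l) x y = (\<Sum>z\<in>V. W (n + l) x z * coeff (if z = y then p else 0) l)"
        using fin xy by (simp add: if_distrib[of "\<lambda>q. coeff q l"] if_distrib[of "(*) _"] mult.commute cong: if_cong)
      also have "\<dots> = (\<Sum>z\<in>V. W (n + l) x z * coeff (pCons 0 (B z y) - (\<Sum>u\<in>V. smult (T z u) (B u y))) l)"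
        using xy by (intro sum.cong refl) (simp add: adj)
      also have "\<dots> = g l - (\<Sum>z\<in>V. \<Sum>u\<in>V. W (n + l) x z * T z u * coeff (B u y) l)"
        by (simp add: g_def coeff_sum algebra_simps sum_subtractf sum_distrib_left)
      also have "(\<Sum>z\<in>V. \<Sum>u\<in>V. W (n + l) x z * T z u * coeff (B u y) l) = g (Suc l)"
        using xy by (subst sum.swap) (simp add: g_def step sum_distrib_right)
      finally show ?thesis .
    qed
    then have "(\<Sum>l\<le>N. coeff p l * W (n + l) x y) = g 0 - g (Suc N)"
      using sum_telescope[of g N] by simp
    also have "g 0 = 0" by (simp add: g_def)
    also have "g (Suc N) = 0"
      unfolding g_def using N(2) by (intro sum.neutral) (simp add: coeff_eq_0)
    finally have "(\<Sum>l\<le>N. coeff p l * W (n + l) x y) = 0" by simp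
    moreover have "(\<Sum>l\<le>N. coeff p l * W (n + l) x y) = (\<Sum>l\<le>degree p. coeff p l * W (n + l) x y)"
      using N(1) by (intro sum.mono_neutral_right) (auto simp: coeff_eq_0)
    ultimately show ?thesis by simp
  qed
  with p that show ?thesis by blast
qed

subsection \<open>Walks of the transfer matrix\<close>

text \<open>
  A state is the set of delays, counted from the current time, after which a landing is pending.
  A throw of height \<open>0\<close> lands at once, so it is made exactly when no landing is due.
\<close>

definition throws :: "nat \<Rightarrow> nat \<Rightarrow> (nat \<Rightarrow> nat) set" where
  "throws L n = {..<n} \<rightarrow>\<^sub>E {..L}"

definition landed :: "nat \<Rightarrow> (nat \<Rightarrow> nat) \<Rightarrow> nat set \<Rightarrow> nat set" where
  "landed n f S = S \<union> (\<lambda>i. i + f i) ` {..<n}"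

text \<open>The constraints of the whole walk in absolute time: no collision among throws or with
  the initial state, and no empty time before n. Peeling off the last throw yields the condition of
  \<open>step_weight\<close>.\<close>

definition valid :: "nat \<Rightarrow> (nat \<Rightarrow> nat) \<Rightarrow> nat set \<Rightarrow> bool" where
  "valid n f S \<longleftrightarrow> inj_on (\<lambda>i. i + f i) {..<n} \<and> S \<inter> (\<lambda>i. i + f i) ` {..<n} = {} \<and>
     {..<n} \<subseteq> landed n f S"

definition state_after :: "nat \<Rightarrow> (nat \<Rightarrow> nat) \<Rightarrow> nat set \<Rightarrow> nat set" where
  "state_after n f S = {j. n + j \<in> landed n f S}"

text \<open>An entry of the n-th power of the transfer matrix, written as a sum over throw sequences
  so that it can be matched with the expanded permanent.\<close>

definition walk_weight :: "(nat \<Rightarrow> 'a :: comm_ring_1) \<Rightarrow> nat \<Rightarrow> nat \<Rightarrow> nat set \<Rightarrow> nat set \<Rightarrow> 'a" where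
  "walk_weight w L n S S' =
     (\<Sum>f\<in>throws L n. if valid n f S \<and> state_after n f S = S' then \<Prod>i<n. w (f i) else 0)"

definition step_weight :: "(nat \<Rightarrow> 'a :: comm_ring_1) \<Rightarrow> nat \<Rightarrow> nat set \<Rightarrow> nat set \<Rightarrow> 'a" where
  "step_weight w L S S' =
     (\<Sum>s\<le>L. if s \<notin> S \<and> 0 \<in> insert s S \<and> {j. Suc j \<in> insert s S} = S' then w s else 0)"

definition states :: "nat \<Rightarrow> nat \<Rightarrow> nat set set" where
  "states L k = {S. S \<subseteq> {..<L} \<and> card S \<le> k}"

lemma finite_throws [simp]: "finite (throws L n)"
  by (simp add: throws_def finite_PiE)

lemma throws_le: "f \<in> throws L n \<Longrightarrow> i < n \<Longrightarrow> f i \<le> L"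
  by (auto simp: throws_def)

lemma finite_states [simp]: "finite (states L k)"
  by (rule finite_subset[of _ "Pow {..<L}"]) (auto simp: states_def)

lemma landed_Suc: "landed (Suc n) (f(n := s)) S = insert (n + s) (landed n f S)"
proof -
  have "(\<lambda>i. i + (f(n := s)) i) ` {..<n} = (\<lambda>i. i + f i) ` {..<n}" by (rule image_cong) auto
  then show ?thesis by (simp add: landed_def lessThan_Suc)
qed

lemma valid_Suc:
  "valid (Suc n) (f(n := s)) S \<longleftrightarrow>
     valid n f S \<and> s \<notin> state_after n f S \<and> 0 \<in> insert s (state_after n f S)"
proof -
  have im: "(\<lambda>i. i + (f(n := s)) i) ` {..<n} = (\<lambda>i. i + f i) ` {..<n}" by (rule image_cong) auto
  have inj: "inj_on (\<lambda>i. i + (f(n := s)) i) {..<n} = inj_on (\<lambda>i. i + f i) {..<n}"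
    by (rule inj_on_cong) auto
  show ?thesis
    unfolding valid_def landed_Suc unfolding lessThan_Suc inj_on_insert image_insert im inj
    by (auto simp: landed_def state_after_def)
qed

lemma state_after_Suc:
  "state_after (Suc n) (f(n := s)) S = {j. Suc j \<in> insert s (state_after n f S)}"
  by (auto simp: state_after_def landed_Suc)

lemma landed_decomp:
  assumes "valid n f S"
  shows "landed n f S = {..<n} \<union> (+) n ` state_after n f S"
proof (intro equalityI subsetI)
  fix x assume "x \<in> landed n f S"
  then show "x \<in> {..<n} \<union> (+) n ` state_after n f S"
    by (cases "x < n") (auto simp: state_after_def image_iff intro!: exI[of _ "x - n"])
qed (use assms in \<open>auto simp: valid_def state_after_def\<close>)

lemma finite_state_after: "finite S \<Longrightarrow> finite (state_after n f S)"
  using finite_vimageI[of "landed n f S" "(+) n"] by (simp add: state_after_def landed_def vimage_def)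

text \<open>Counting the landing times in two ways: n new ones join S, and exactly n of them lie
  before time n.\<close>

lemma card_state_after:
  assumes "valid n f S" "finite S"
  shows "card (state_after n f S) = card S"
proof -
  have "card (landed n f S) = card S + n"
    using assms by (simp add: valid_def landed_def card_Un_disjoint card_image)
  moreover have "card (landed n f S) = n + card (state_after n f S)"
    unfolding landed_decomp[OF assms(1)]
    using finite_state_after[OF assms(2)] by (subst card_Un_disjoint) (auto simp: card_image)
  ultimately show ?thesis by simp
qed

lemma state_after_in_states:
  assumes "valid n f S" "S \<in> states L k" "f \<in> throws L n"
  shows "state_after n f S \<in> states L k"
proof -
  have "state_after n f S \<subseteq> {..<L}"
    using assms by (fastforce simp: states_def state_after_def landed_def dest: throws_le)
  moreover have "card (state_after n f S) = card S"
    using assms finite_subset[of S "{..<L}"] by (intro card_state_after) (auto simp: states_def)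
  ultimately show ?thesis using assms(2) by (simp add: states_def)
qed

lemma sum_throws_Suc:
  "(\<Sum>f\<in>throws L (Suc n). F f) = (\<Sum>f\<in>throws L n. \<Sum>s\<le>L. F (f(n := s)))"
proof -
  have "throws L (Suc n) = (\<lambda>(s, f). f(n := s)) ` ({..L} \<times> throws L n)"
    by (simp add: throws_def lessThan_Suc PiE_insert_eq)
  moreover have "inj_on (\<lambda>(s, f). f(n := s)) ({..L} \<times> throws L n)"
    unfolding throws_def by (rule inj_combinator) simp
  ultimately have "(\<Sum>f\<in>throws L (Suc n). F f) = (\<Sum>(s, f)\<in>{..L} \<times> throws L n. F (f(n := s)))"
    by (simp only: sum.reindex) (simp add: comp_def case_prod_beta)
  then show ?thesis by (simp add: sum.cartesian_product[symmetric] sum.swap[of _ "{..L}"])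
qed

text \<open>Splitting off the last throw. Intermediate states may be confined to
  \<open>states L k\<close> because the cardinality is conserved.\<close>

lemma walk_weight_Suc:
  assumes S: "S \<in> states L k"
  shows "walk_weight w L (Suc n) S S' =
    (\<Sum>U\<in>states L k. walk_weight w L n S U * step_weight w L U S')"
proof -
  let ?Q = "\<lambda>U s. s \<notin> U \<and> 0 \<in> insert s U \<and> {j. Suc j \<in> insert s U} = S'"
  let ?Z = "\<lambda>f. state_after n f S"
  have "(\<Sum>U\<in>states L k. walk_weight w L n S U * step_weight w L U S') =
      (\<Sum>U\<in>states L k. \<Sum>f\<in>throws L n. \<Sum>s\<le>L.
        if U = ?Z f then if valid n f S \<and> ?Q U s then (\<Prod>i<n. w (f i)) * w s else 0 else 0)"
    unfolding walk_weight_def step_weight_def sum_product by (intro sum.cong refl) auto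
  also have "\<dots> = (\<Sum>f\<in>throws L n. \<Sum>s\<le>L. \<Sum>U\<in>states L k.
        if U = ?Z f then if valid n f S \<and> ?Q U s then (\<Prod>i<n. w (f i)) * w s else 0 else 0)"
    by (subst sum.swap, rule sum.cong[OF refl], rule sum.swap)
  \<comment> \<open>The sum over U collapses to the state actually reached; if f is not valid, both
    sides vanish.\<close>
  also have "\<dots> = (\<Sum>f\<in>throws L n. \<Sum>s\<le>L.
        if valid n f S \<and> ?Q (?Z f) s then (\<Prod>i<n. w (f i)) * w s else 0)"
    using state_after_in_states[OF _ S] by (intro sum.cong refl) (subst sum.delta; auto)
  also have "\<dots> = walk_weight w L (Suc n) S S'"
    unfolding walk_weight_def sum_throws_Suc valid_Suc state_after_Suc
    by (intro sum.cong refl if_cong) auto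
  finally show ?thesis ..
qed

section \<open>Closed walks as periodic patterns\<close>

definition cyclic_throws :: "nat \<Rightarrow> nat \<Rightarrow> (nat \<Rightarrow> nat) set" where
  "cyclic_throws L n = {f \<in> throws L n. inj_on (\<lambda>i. (i + f i) mod n) {..<n}}"

definition wraps :: "nat \<Rightarrow> (nat \<Rightarrow> nat) \<Rightarrow> nat set" where
  "wraps n f = {j. n + j \<in> (\<lambda>i. i + f i) ` {..<n}}"

lemma wraps_subset: "f \<in> throws L n \<Longrightarrow> wraps n f \<subseteq> {..<L}"
  by (fastforce simp: wraps_def dest: throws_le)

text \<open>As L is at most n, every initially pending landing occurs before time n, so the final
  state consists of overshooting throws only. A closed walk thus determines its base state, and
  validity becomes distinctness of the landing times modulo n.\<close>

lemma closed_walk_iff: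
  assumes n: "L \<le> n" and S: "S \<subseteq> {..<L}" and f: "f \<in> throws L n"
  shows "valid n f S \<and> state_after n f S = S \<longleftrightarrow> f \<in> cyclic_throws L n \<and> wraps n f = S"
proof -
  have state: "state_after n f S = wraps n f"
  proof -
    have "n + j \<notin> S" for j using n S by fastforce
    then show ?thesis by (simp add: state_after_def landed_def wraps_def)
  qed
  define h where "h = (\<lambda>i. i + f i)"
  \<comment> \<open>Hence reduction modulo n subtracts n at most once.\<close>
  have h_less: "h i < 2 * n" if "i < n" for i
    using throws_le[OF f that] that n by (simp add: h_def)
  have h_mod: "h i = h i mod n \<or> h i = n + h i mod n" if "i < n" for i
  proof (cases "h i < n")
    case False
    then have "h i mod n = h i - n" using h_less[OF that] by (simp add: le_mod_geq)
    then show ?thesis using False by simp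
  qed simp
  have wraps_h: "j \<in> wraps n f \<longleftrightarrow> (\<exists>i<n. h i = n + j)" for j
    unfolding wraps_def h_def image_iff Bex_def lessThan_iff mem_Collect_eq by metis
  have h_im: "j \<in> h ` {..<n} \<longleftrightarrow> (\<exists>i<n. h i = j)" for j by auto
  have "valid n f S \<longleftrightarrow> inj_on (\<lambda>i. h i mod n) {..<n}" if wr: "wraps n f = S"
  proof
    assume v: "valid n f S"
    \<comment> \<open>Each residue is hit directly or, if it lies in S, by a throw that wraps
      around; surjectivity on a finite set then gives injectivity.\<close>
    have "{..<n} \<subseteq> (\<lambda>i. h i mod n) ` {..<n}"
    proof
      fix k assume k: "k \<in> {..<n}"
      then have "k \<in> S \<or> k \<in> h ` {..<n}" using v unfolding valid_def landed_def h_def by blast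
      then obtain i where "i < n" "h i = k \<or> h i = n + k" using wr wraps_h h_im by blast
      then show "k \<in> (\<lambda>i. h i mod n) ` {..<n}" using k by (intro image_eqI[of _ _ i]) auto
    qed
    then show "inj_on (\<lambda>i. h i mod n) {..<n}" by (rule finite_surj_inj[rotated]) simp
  next
    assume inj: "inj_on (\<lambda>i. h i mod n) {..<n}"
    then have surj: "(\<lambda>i. h i mod n) ` {..<n} = {..<n}" by (intro endo_inj_surj) auto
    have "inj_on h {..<n}"
      using inj inj_on_imageI2[of "\<lambda>x. x mod n" h] by (simp add: comp_def)
    \<comment> \<open>A landing in S would share its residue with the wrapping throw that put this
      time into S.\<close>
    moreover have "S \<inter> h ` {..<n} = {}"
    proof (rule ccontr)
      assume "S \<inter> h ` {..<n} \<noteq> {}"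
      then obtain i where i: "i < n" "h i \<in> S" by auto
      then obtain i' where i': "i' < n" "h i' = n + h i"
        using wr wraps_h by blast
      then have "h i' mod n = h i mod n" by simp
      then have "i = i'" using inj_onD[OF inj, of i i'] i(1) i'(1) by simp
      then have "h i = h i'" by (rule arg_cong)
      then show False using i'(2) i(1) by linarith
    qed
    moreover have "{..<n} \<subseteq> landed n f S"
    proof
      fix k assume "k \<in> {..<n}"
      then have "k \<in> (\<lambda>i. h i mod n) ` {..<n}" using surj by simp
      then obtain i where "i < n" "k = h i mod n" by blast
      then have "h i = k \<or> h i = n + k" using h_mod[of i] by simp
      then have "k \<in> h ` {..<n} \<or> k \<in> wraps n f"
        using \<open>i < n\<close> wraps_h h_im by blast
      then show "k \<in> landed n f S" using wr unfolding landed_def h_def by blast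
    qed
    ultimately show "valid n f S" by (simp add: valid_def h_def)
  qed
  then show ?thesis unfolding state cyclic_throws_def mem_Collect_eq h_def using f by blast
qed

text \<open>The average theorem for juggling patterns: the mean throw is the number of balls. The
  landing times are summed in two ways, as S with all \<open>i + f i\<close>, and as the times
  before n with S shifted by n.\<close>

lemma sum_cyclic_throws:
  assumes n: "L \<le> n" and f: "f \<in> cyclic_throws L n"
  shows "(\<Sum>i<n. f i) = n * card (wraps n f)"
proof -
  let ?S = "wraps n f"
  have f': "f \<in> throws L n" using f by (simp add: cyclic_throws_def)
  have v: "valid n f ?S" "state_after n f ?S = ?S"
    using closed_walk_iff[OF n wraps_subset[OF f'] f'] f by auto
  have fin: "finite ?S" using wraps_subset[OF f'] finite_subset by blast
  have "(\<Sum>x\<in>landed n f ?S. x) = \<Sum>?S + (\<Sum>i<n. i + f i)"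
    using v(1) fin by (simp add: landed_def valid_def sum.union_disjoint sum.reindex)
  moreover have "(\<Sum>x\<in>landed n f ?S. x) = \<Sum>{..<n} + (\<Sum>j\<in>?S. n + j)"
    unfolding landed_decomp[OF v(1)] v(2) using fin
    by (subst sum.union_disjoint) (auto simp: sum.reindex)
  ultimately show ?thesis by (simp add: sum.distrib mult.commute)
qed

text \<open>Each cyclic pattern is a closed walk at exactly one state, \<open>wraps n f\<close>. The
  free factor \<open>c\<close> will carry the multiplicities of the folding.\<close>

lemma sum_walk_weight:
  assumes n: "L \<le> n"
  shows "(\<Sum>S\<in>states L k. c S * walk_weight w L n S S) =
    (\<Sum>f | f \<in> cyclic_throws L n \<and> card (wraps n f) \<le> k. c (wraps n f) * (\<Prod>i<n. w (f i)))"
proof -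
  have "(\<Sum>S\<in>states L k. c S * walk_weight w L n S S) =
    (\<Sum>S\<in>states L k. \<Sum>f\<in>throws L n. if S = wraps n f then
       if f \<in> cyclic_throws L n then c S * (\<Prod>i<n. w (f i)) else 0 else 0)"
    unfolding walk_weight_def sum_distrib_left
    using closed_walk_iff[OF n] by (intro sum.cong refl) (auto simp: states_def)
  also have "\<dots> = (\<Sum>f\<in>throws L n. if wraps n f \<in> states L k then
       if f \<in> cyclic_throws L n then c (wraps n f) * (\<Prod>i<n. w (f i)) else 0 else 0)"
    by (subst sum.swap) (simp add: sum.delta)
  also have "\<dots> = (\<Sum>f\<in>throws L n. if f \<in> cyclic_throws L n \<and> card (wraps n f) \<le> k
      then c (wraps n f) * (\<Prod>i<n. w (f i)) else 0)"
    using wraps_subset by (intro sum.cong refl) (auto simp: states_def)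
  also have "\<dots> = (\<Sum>f | f \<in> cyclic_throws L n \<and> card (wraps n f) \<le> k. c (wraps n f) * (\<Prod>i<n. w (f i)))"
    by (intro sum.mono_neutral_cong_right) (auto simp: cyclic_throws_def)
  finally show ?thesis .
qed

section \<open>Reversal symmetry\<close>

definition reverse_throws :: "nat \<Rightarrow> nat \<Rightarrow> (nat \<Rightarrow> nat) \<Rightarrow> nat \<Rightarrow> nat" where
  "reverse_throws L n f = restrict (\<lambda>i. L - f (n - 1 - i)) {..<n}"

lemma reverse_throws_involutive:
  assumes "f \<in> throws L n"
  shows "reverse_throws L n (reverse_throws L n f) = f"
proof
  fix i
  show "reverse_throws L n (reverse_throws L n f) i = f i"
  proof (cases "i < n")
    case True
    then have "n - 1 - (n - 1 - i) = i" "n - 1 - i < n" by auto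
    with True show ?thesis using throws_le[OF assms True] by (simp add: reverse_throws_def)
  next
    case False
    then have "f i = undefined" using assms PiE_arb[of f "{..<n}" _ i] unfolding throws_def by blast
    with False show ?thesis by (simp add: reverse_throws_def)
  qed
qed

text \<open>Under reversal every landing time x becomes \<open>n - 1 + L - x\<close>, which
  preserves distinctness modulo n. The argument runs in the integers to avoid truncated
  subtraction.\<close>

lemma reverse_cyclic_throws:
  assumes f: "f \<in> cyclic_throws L n"
  shows "reverse_throws L n f \<in> cyclic_throws L n"
proof -
  have ft: "f \<in> throws L n" using f by (simp add: cyclic_throws_def)
  let ?g = "reverse_throws L n f"
  have "?g \<in> throws L n" by (auto simp: reverse_throws_def throws_def)
  moreover have "inj_on (\<lambda>i. (i + ?g i) mod n) {..<n}"
  proof (rule inj_onI)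
    fix i j assume ij: "i \<in> {..<n}" "j \<in> {..<n}" and eq: "(i + ?g i) mod n = (j + ?g j) mod n"
    let ?r = "\<lambda>i. n - 1 - i"
    have g: "int (n - 1 + L) - int (k + ?g k) = int (?r k + f (?r k))" if "k < n" for k
      using that throws_le[OF ft, of "?r k"] by (simp add: reverse_throws_def of_nat_diff)
    have "[int (i + ?g i) = int (j + ?g j)] (mod int n)"
      using eq cong_int_iff[of "i + ?g i" "j + ?g j" n] by (simp only: cong_def)
    then have "[int (n - 1 + L) - int (i + ?g i) = int (n - 1 + L) - int (j + ?g j)] (mod int n)"
      by (rule cong_diff[OF cong_refl])
    then have "[int (?r i + f (?r i)) = int (?r j + f (?r j))] (mod int n)"
      using g ij by (simp only: lessThan_iff)
    then have eq': "(?r i + f (?r i)) mod n = (?r j + f (?r j)) mod n"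
      unfolding cong_int_iff unfolding cong_def .
    have inj: "inj_on (\<lambda>i. (i + f i) mod n) {..<n}" using f by (simp add: cyclic_throws_def)
    have "?r i = ?r j"
      by (rule inj_onD[OF inj]) (use eq' ij in auto)
    then show "i = j" using ij by auto
  qed
  ultimately show ?thesis by (simp add: cyclic_throws_def)
qed

text \<open>The heights of a pattern and of its reversal add up to n L; the average theorem divides
  this by n.\<close>

lemma card_wraps_reverse:
  assumes n: "L \<le> n" "0 < n" and f: "f \<in> cyclic_throws L n"
  shows "card (wraps n f) + card (wraps n (reverse_throws L n f)) = L"
proof -
  have ft: "f \<in> throws L n" using f by (simp add: cyclic_throws_def)
  have "(\<Sum>i<n. reverse_throws L n f i) = (\<Sum>i<n. L - f (n - Suc i))"
    by (intro sum.cong) (auto simp: reverse_throws_def)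
  also have "\<dots> = (\<Sum>i<n. L - f i)" by (rule sum.nat_diff_reindex)
  finally have "(\<Sum>i<n. f i) + (\<Sum>i<n. reverse_throws L n f i) = (\<Sum>i<n. L)"
    using throws_le[OF ft] by (simp flip: sum.distrib)
  then have "n * (card (wraps n f) + card (wraps n (reverse_throws L n f))) = n * L"
    using sum_cyclic_throws[OF n(1)] f reverse_cyclic_throws[OF f] by (simp add: distrib_left)
  then show ?thesis using n by simp
qed

lemma prod_reverse_throws:
  assumes "f \<in> throws L n" and w: "\<And>s. s \<le> L \<Longrightarrow> w (L - s) = w s"
  shows "(\<Prod>i<n. w (reverse_throws L n f i)) = (\<Prod>i<n. w (f i))"
proof -
  have "(\<Prod>i<n. w (reverse_throws L n f i)) = (\<Prod>i<n. w (f (n - Suc i)))"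
    using throws_le[OF assms(1)] by (intro prod.cong) (auto simp: reverse_throws_def w)
  also have "\<dots> = (\<Prod>i<n. w (f i))" by (rule prod.nat_diff_reindex)
  finally show ?thesis .
qed

text \<open>Reversal matches the patterns with more than m balls to those with fewer, at equal
  weight. The latter therefore count twice, and those with exactly m balls once.\<close>

lemma sum_cyclic_throws_eq_sum_walks:
  fixes w :: "nat \<Rightarrow> 'a :: comm_ring_1"
  assumes n: "2 * m \<le> n" "0 < n" and w: "\<And>s. s \<le> 2 * m \<Longrightarrow> w (2 * m - s) = w s"
  shows "(\<Sum>f\<in>cyclic_throws (2 * m) n. \<Prod>i<n. w (f i)) =
    (\<Sum>S\<in>states (2 * m) m. (if card S < m then 2 else 1) * walk_weight w (2 * m) n S S)"
proof -
  let ?C = "cyclic_throws (2 * m) n" and ?r = "reverse_throws (2 * m) n"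
  let ?P = "\<lambda>f. \<Prod>i<n. w (f i)" and ?k = "\<lambda>f. card (wraps n f)"
  have fin: "finite ?C" by (simp add: cyclic_throws_def)
  have C: "f \<in> throws (2 * m) n" if "f \<in> ?C" for f using that by (simp add: cyclic_throws_def)
  have prod_r: "?P (?r f) = ?P f" if "f \<in> ?C" for f
    using C[OF that] w by (rule prod_reverse_throws)
  have swap: "(\<Sum>f | f \<in> ?C \<and> m < ?k f. ?P f) = (\<Sum>f | f \<in> ?C \<and> ?k f < m. ?P f)"
  proof (rule sum.reindex_bij_witness[of _ ?r ?r])
    fix f assume "f \<in> {f \<in> ?C. m < ?k f}"
    then show "?r (?r f) = f" "?r f \<in> {f \<in> ?C. ?k f < m}" "?P (?r f) = ?P f"
      using reverse_throws_involutive[OF C] reverse_cyclic_throws[of f] card_wraps_reverse[OF n, of f]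
        prod_r by auto
  next
    fix f assume "f \<in> {f \<in> ?C. ?k f < m}"
    then show "?r (?r f) = f" "?r f \<in> {f \<in> ?C. m < ?k f}"
      using reverse_throws_involutive[OF C] reverse_cyclic_throws[of f] card_wraps_reverse[OF n, of f]
      by auto
  qed
  have split: "{f \<in> ?C. ?k f \<le> m} = {f \<in> ?C. ?k f < m} \<union> {f \<in> ?C. ?k f = m}"
    "?C = {f \<in> ?C. ?k f \<le> m} \<union> {f \<in> ?C. m < ?k f}" by auto
  have "(\<Sum>S\<in>states (2 * m) m. (if card S < m then 2 else 1) * walk_weight w (2 * m) n S S) =
      (\<Sum>f | f \<in> ?C \<and> ?k f \<le> m. (if ?k f < m then 2 else 1) * ?P f)"
    by (rule sum_walk_weight[OF n(1)])
  also have "\<dots> = (\<Sum>f | f \<in> ?C \<and> ?k f < m. 2 * ?P f) + (\<Sum>f | f \<in> ?C \<and> ?k f = m. ?P f)"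
    unfolding split(1) using fin by (subst sum.union_disjoint) auto
  also have "\<dots> = (\<Sum>f | f \<in> ?C \<and> ?k f < m. ?P f) + (\<Sum>f | f \<in> ?C \<and> ?k f = m. ?P f) +
      (\<Sum>f | f \<in> ?C \<and> m < ?k f. ?P f)"
    by (simp add: swap flip: sum_distrib_left)
  also have "\<dots> = (\<Sum>f | f \<in> ?C \<and> ?k f \<le> m. ?P f) + (\<Sum>f | f \<in> ?C \<and> m < ?k f. ?P f)"
    unfolding split(1) using fin by (subst sum.union_disjoint) auto
  also have "\<dots> = sum ?P ?C"
    by (subst (3) split(2), subst sum.union_disjoint) (use fin in auto)
  finally show ?thesis ..
qed

section \<open>Number of states\<close>

text \<open>By symmetry the lower and upper halves of the binomial row have equal sums; together
  they cover the row, with only the middle term counted twice.\<close>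

lemma card_states: "2 * card (states (2 * m) m) = 4 ^ m + (2 * m choose m)"
proof -
  have "states (2 * m) m = (\<Union>k\<le>m. {S. S \<subseteq> {..<2 * m} \<and> card S = k})"
    by (auto simp: states_def)
  also have "card \<dots> = (\<Sum>k\<le>m. 2 * m choose k)"
    by (subst card_UN_disjoint) (auto simp: n_subsets)
  finally have c: "card (states (2 * m) m) = (\<Sum>k\<le>m. 2 * m choose k)" .
  have "(\<Sum>k\<le>m. 2 * m choose k) = (\<Sum>k\<in>{m..2 * m}. 2 * m choose k)"
    by (rule sum.reindex_bij_witness[of _ "\<lambda>k. 2 * m - k" "\<lambda>k. 2 * m - k"])
      (auto simp: binomial_symmetric[symmetric])
  also have "\<dots> = (2 * m choose m) + (\<Sum>k\<in>{m<..2 * m}. 2 * m choose k)"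
    by (simp add: sum.head)
  finally have "2 * (\<Sum>k\<le>m. 2 * m choose k) =
      (2 * m choose m) + ((\<Sum>k\<le>m. 2 * m choose k) + (\<Sum>k\<in>{m<..2 * m}. 2 * m choose k))" by simp
  also have "(\<Sum>k\<le>m. 2 * m choose k) + (\<Sum>k\<in>{m<..2 * m}. 2 * m choose k) =
      (\<Sum>k\<le>2 * m. 2 * m choose k)"
    by (subst sum.union_disjoint[symmetric]) (auto intro!: sum.cong)
  also have "\<dots> = 4 ^ m" by (simp add: choose_row_sum power_mult)
  finally show ?thesis by (simp add: c)
qed

section \<open>Expansion of the permanent\<close>

text \<open>The congruences determine p, so at most one permutation contributes; the only candidate
  is a permutation exactly if the landing times are distinct modulo n.\<close>

lemma sum_permutes_eq_if_inj:
  fixes f :: "nat \<Rightarrow> nat"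
  assumes n: "m \<le> n"
  shows "(\<Sum>p | p permutes {0..<n}. if \<forall>i<n. [p i + m = i + f i] (mod n) then x else 0) =
    (if inj_on (\<lambda>i. (i + f i) mod n) {..<n} then x else 0)"
proof -
  \<comment> \<open>Adding \<open>n - m\<close> subtracts m modulo n without truncation; outside the
    range q is the identity, as \<open>permutes\<close> demands.\<close>
  define q where "q = (\<lambda>i. if i < n then (i + f i + (n - m)) mod n else i)"
  have q_cong: "[q i + m = i + f i] (mod n)" if "i < n" for i
    using that n by (simp add: q_def cong_def mod_simps)
  have eq_q: "p = q" if p: "p permutes {0..<n}" and c: "\<forall>i<n. [p i + m = i + f i] (mod n)" for p
  proof
    fix i
    show "p i = q i"
    proof (cases "i < n")
      case True
      then have "[p i + m = q i + m] (mod n)" using c q_cong by (meson cong_sym cong_trans)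
      then have "[p i = q i] (mod n)" by (simp only: cong_add_rcancel_nat)
      moreover have "p i < n" using permutes_in_image[OF p, of i] True by simp
      moreover have "q i < n" using True by (simp add: q_def)
      ultimately show ?thesis by (simp add: cong_def)
    qed (use permutes_not_in[OF p, of i] in \<open>simp add: q_def\<close>)
  qed
  have inj_q: "inj_on q {..<n} \<longleftrightarrow> inj_on (\<lambda>i. (i + f i) mod n) {..<n}"
  proof -
    have "q i = q j \<longleftrightarrow> (i + f i) mod n = (j + f j) mod n" if "i < n" "j < n" for i j
      using that cong_add_rcancel_nat[of "i + f i" "n - m" "j + f j" n]
      by (simp add: q_def cong_def)
    then show ?thesis by (auto simp: inj_on_def)
  qed
  have q_into: "q ` {..<n} \<subseteq> {..<n}" by (auto simp: q_def)
  have perm_q: "q permutes {0..<n} \<longleftrightarrow> inj_on q {..<n}"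
  proof
    assume "inj_on q {..<n}"
    then have "bij_betw q {..<n} {..<n}"
      unfolding bij_betw_def by (metis endo_inj_surj finite_lessThan q_into)
    moreover have "q i = i" if "i \<notin> {..<n}" for i using that by (simp add: q_def)
    ultimately show "q permutes {0..<n}"
      unfolding atLeast0LessThan by (rule bij_imp_permutes)
  next
    assume "q permutes {0..<n}"
    then show "inj_on q {..<n}" by (rule permutes_inj_on)
  qed
  have "(\<Sum>p | p permutes {0..<n}. if \<forall>i<n. [p i + m = i + f i] (mod n) then x else 0) =
      (\<Sum>p | p permutes {0..<n}. if p = q then x else 0)"
    using eq_q q_cong by (intro sum.cong refl if_cong) blast+
  also have "\<dots> = (if q permutes {0..<n} then x else 0)"
    by (simp add: finite_permutations)
  finally show ?thesis by (simp add: perm_q inj_q)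
qed

lemma permanent_banded_circulant:
  assumes n: "2 * m < n"
  shows "permanent (banded_circulant m a n) =
    (\<Sum>f\<in>cyclic_throws (2 * m) n. \<Prod>i<n. a (int (f i) - int m))"
proof -
  have n1: "n \<ge> 1" using n by simp
  let ?w = "\<lambda>t. a (int t - int m)"
  \<comment> \<open>The substitution t = s + m turns band offsets into throw heights.\<close>
  have entry: "(\<Sum>s | s \<in> {- int m..int m} \<and> [int j = int i + s] (mod int n). a s) =
      (\<Sum>t\<le>2 * m. if [j + m = i + t] (mod n) then ?w t else 0)" for i j
  proof -
    have "(\<Sum>s | s \<in> {- int m..int m} \<and> [int j = int i + s] (mod int n). a s) =
        (\<Sum>t | t \<le> 2 * m \<and> [j + m = i + t] (mod n). ?w t)"
    proof (rule sum.reindex_bij_witness[of _ "\<lambda>t. int t - int m" "\<lambda>s. nat (s + int m)"])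
      fix s assume s: "s \<in> {s. s \<in> {- int m..int m} \<and> [int j = int i + s] (mod int n)}"
      then have "[int j + int m = int i + s + int m] (mod int n)" by (simp add: cong_add_rcancel)
      then have "[int (j + m) = int (i + nat (s + int m))] (mod int n)"
        using s by (simp add: algebra_simps)
      then show "nat (s + int m) \<in> {t. t \<le> 2 * m \<and> [j + m = i + t] (mod n)}"
        using s by (simp only: cong_int_iff) (simp add: nat_le_iff)
    next
      fix t assume t: "t \<in> {t. t \<le> 2 * m \<and> [j + m = i + t] (mod n)}"
      then have "[int (j + m) = int (i + t)] (mod int n)" by (simp only: cong_int_iff mem_Collect_eq)
      then have "[int j + int m = (int i + (int t - int m)) + int m] (mod int n)"
        by (simp add: algebra_simps)
      then have "[int j = int i + (int t - int m)] (mod int n)" by (simp only: cong_add_rcancel)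
      then show "int t - int m \<in> {s. s \<in> {- int m..int m} \<and> [int j = int i + s] (mod int n)}"
        using t by auto
    qed auto
    also have "\<dots> = (\<Sum>t\<le>2 * m. if [j + m = i + t] (mod n) then ?w t else 0)"
      by (intro sum.mono_neutral_cong_left) auto
    finally show ?thesis .
  qed
  have "permanent (banded_circulant m a n) =
      (\<Sum>p | p permutes {0..<n}. \<Prod>i<n. \<Sum>t\<le>2 * m. if [p i + m = i + t] (mod n) then ?w t else 0)"
    unfolding permanent_def banded_circulant_eq_mat[OF n1] entry
    by (auto simp: lessThan_atLeast0 permutes_in_image intro!: sum.cong prod.cong)
  \<comment> \<open>Distributing the product over the sums chooses one height per row, that is, one
    throw sequence.\<close>
  also have "\<dots> = (\<Sum>p | p permutes {0..<n}. \<Sum>f\<in>throws (2 * m) n.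
      \<Prod>i<n. if [p i + m = i + f i] (mod n) then ?w (f i) else 0)"
    by (simp add: throws_def prod_sum_PiE)
  also have "\<dots> = (\<Sum>p | p permutes {0..<n}. \<Sum>f\<in>throws (2 * m) n.
      if \<forall>i<n. [p i + m = i + f i] (mod n) then \<Prod>i<n. ?w (f i) else 0)"
    by (intro sum.cong refl) (auto intro!: prod_zero)
  also have "\<dots> = (\<Sum>f\<in>throws (2 * m) n. if inj_on (\<lambda>i. (i + f i) mod n) {..<n}
      then \<Prod>i<n. ?w (f i) else 0)"
    using n by (subst sum.swap, simp only: sum_permutes_eq_if_inj)
  also have "\<dots> = (\<Sum>f\<in>cyclic_throws (2 * m) n. \<Prod>i<n. ?w (f i))"
    by (intro sum.mono_neutral_cong_right) (auto simp: cyclic_throws_def)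
  finally show ?thesis .
qed

section \<open>The annihilator\<close>

theorem theorem6p8:
  fixes m :: nat and a :: "int \<Rightarrow> complex"
  assumes "m \<ge> 1"
    and "\<And>s. 0 \<le> s \<Longrightarrow> s \<le> int m \<Longrightarrow> a (- s) = a s"
  shows "\<exists>p :: complex poly.
           annihilator_beyond (2 * m) (\<lambda>n. permanent (banded_circulant m a n)) p \<and>
           real (degree p) \<le> 1 / 2 * (4 ^ m + real ((2 * m) choose m))"
proof -
  define w where "w = (\<lambda>t. a (int t - int m))"
  let ?V = "states (2 * m) m" and ?W = "walk_weight w (2 * m)"
  let ?c = "\<lambda>S. if card S < m then 2 else 1 :: complex"
  \<comment> \<open>Reflecting s about m negates the argument of a. The symmetry hypothesis covers
    nonnegative arguments only, hence the two cases.\<close>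
  have w: "w (2 * m - s) = w s" if "s \<le> 2 * m" for s
  proof (cases "m \<le> s")
    case True
    with that show ?thesis using assms(2)[of "int s - int m"] by (simp add: w_def of_nat_diff)
  next
    case False
    with that show ?thesis using assms(2)[of "int m - int s"] by (simp add: w_def of_nat_diff)
  qed
  \<comment> \<open>The coefficients do not depend on n, so a recurrence shared by all walk weights
    passes to the permanents.\<close>
  have perm: "permanent (banded_circulant m a n) = (\<Sum>S\<in>?V. ?c S * ?W n S S)" if n: "n > 2 * m" for n
    using sum_cyclic_throws_eq_sum_walks[of m n w] w n
    by (simp add: permanent_banded_circulant[OF n] w_def)
  obtain p where p: "lead_coeff p = 1" "degree p = card ?V"
    "\<And>n x y. x \<in> ?V \<Longrightarrow> y \<in> ?V \<Longrightarrow> (\<Sum>i\<le>degree p. coeff p i * ?W (n + i) x y) = 0"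
    using Cayley_Hamilton_recurrence[of ?V ?W "step_weight w (2 * m)", OF finite_states
        walk_weight_Suc[of _ "2 * m" m w]] by blast
  have "(\<Sum>i\<le>degree p. coeff p i * permanent (banded_circulant m a (n + i))) = 0" if n: "n > 2 * m" for n
  proof -
    have "(\<Sum>i\<le>degree p. coeff p i * permanent (banded_circulant m a (n + i))) =
        (\<Sum>i\<le>degree p. \<Sum>S\<in>?V. ?c S * (coeff p i * ?W (n + i) S S))"
      using n by (simp add: perm sum_distrib_left mult.left_commute)
    also have "\<dots> = (\<Sum>S\<in>?V. ?c S * (\<Sum>i\<le>degree p. coeff p i * ?W (n + i) S S))"
      by (subst sum.swap) (simp add: sum_distrib_left)
    also have "\<dots> = 0" by (simp add: p(3))
    finally show ?thesis .
  qed
  then have "annihilator_beyond (2 * m) (\<lambda>n. permanent (banded_circulant m a n)) p"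
    using p(1) by (simp add: annihilator_beyond_def)
  moreover have "2 * real (degree p) = 4 ^ m + real (2 * m choose m)"
    using arg_cong[OF card_states[of m], of real] p(2) by simp
  ultimately show ?thesis by (intro exI[of _ p]) simp
qed

end
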